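(* Let $S$ be a cancellative and right amenable monoid, $G=S^{-1}S$ its group of left fractions, $K$ a compact (Hausdorff) space and $\rho$ a right $S$-action on $K$ by continuous self-maps. Let $\bar K=\bigcap_{t\in S}\rho_t(K)$ and $\bar\rho_s=\rho_s|_{\bar K}$. Consider the inverse system indexed by $(G,\le_S)$ with $K_g=\bar K$ for all $g\in G$ and transition maps $\bar\rho_s\colon K_g\to K_{gs}$ ($g\in G$, $s\in S$); let $K^*$ be its inverse limit, with canonical maps $\pi_g=\pi_g^K\colon K^*\to K_g$, $g\in G$. Then: (1) $\pi_g$ is surjective and $\pi_{gs}=\bar\rho_s\circ\pi_g$, for all $g\in G$ and $s\in S$; (2) for $g\in G$ let $\rho^*_g\colon K^*\to K^*$ be the unique continuous map such that $\pi_h\circ\rho^*_g=\pi_{gh}$ for all $h\in G$; then $\rho^*$ is a right $G$-action on $K^*$; (3) $\pi_1\colon K^*\to\bar K$ is (surjective and) $S$-equivariant, when $K^*$ is endowed with the restriction of the action $\rho^*$ to $S$ (and $\bar K$ with $\bar\rho$); (4) given a second right $S$-action $\rho'$ on a compact space $K'$ and an $S$-equivariant continuous map $\phi\colon K\to K'$, there is a unique continuous map $\phi^*\colon K^*\to(K')^*$ such that $\pi^{K'}_g\circ\phi^*=\bar\phi\circ\pi^K_g$ for every $g\in G$. Furthermore, $\phi^*$ is $G$-equivariant and if $\phi$ is injective (resp., surjective) then so is $\phi^*$.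
   Context: A cancellative monoid $S$ is right amenable if it admits a right F{\o}lner net, i.e. a net $\{F_i\}_{i\in I}$ of non-empty finite subsets of $S$ such that $\lim_{i\in I}|F_is\setminus F_i|/|F_i|=0$ for every $s\in S$. Such an $S$ satisfies the left Ore condition ($Ss\cap St\ne\emptyset$ for all $s,t\in S$) and so embeds in its group of left fractions $G=S^{-1}S$, in which every element has the form $s^{-1}t$ with $s,t\in S$. Preorder $G$ by $g_1\le_S g_2$ iff $g_2^{-1}g_1\in S$; this is directed. A right $S$-action $\rho$ on a compact space $K$ is a family of continuous self-maps $\rho_s$ with $\rho_1=\mathrm{id}_K$, $\rho_{st}=\rho_t\circ\rho_s$ (similarly for $G$). A map $\phi\colon K\to K'$ is $S$-equivariant if $\phi\circ\rho_s=\rho'_s\circ\phi$ for all $s\in S$. $\bar K$ is closed in $K$ and $\rho_s(\bar K)=\bar K$ for all $s\in S$. For an $S$-equivariant continuous map $\phi\colon K\to K'$ one has $\phi(\bar K)\subseteq\bar K'$, and $\bar\phi\colon\bar K\to\bar K'$ denotes the restriction of $\phi$. The space $(K')^*$ and the maps $\pi_g^{K'}$ are constructed from $\rho'$ as $K^*$ and $\pi_g^K$ are from $\rho$. *)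

theory Defs
  imports "HOL-Analysis.Analysis" "HOL-Algebra.Divisibility" "HOL-Algebra.Coset"
begin

text \<open>
  The limit of a net indexed by a directed preorder is taken along the filter generated by
  its tails \<open>{i \<in> I. leq i0 i}\<close>. A cancellative monoid is right amenable iff it admits a
  right Foelner net, over some index type; HOL cannot quantify existentially over types, so a
  hypothesis of right amenability is stated by fixing such a net, with an arbitrary index type.
\<close>

definition directed_preorder :: "'i set \<Rightarrow> ('i \<Rightarrow> 'i \<Rightarrow> bool) \<Rightarrow> bool" where
  "directed_preorder I leq \<longleftrightarrow>
     I \<noteq> {} \<and>
     (\<forall>i\<in>I. leq i i) \<and>
     (\<forall>i\<in>I. \<forall>j\<in>I. \<forall>k\<in>I. leq i j \<longrightarrow> leq j k \<longrightarrow> leq i k) \<and>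
     (\<forall>i\<in>I. \<forall>j\<in>I. \<exists>k\<in>I. leq i k \<and> leq j k)"

definition right_Folner_net ::
  "('s, 'm) monoid_scheme \<Rightarrow> 'i set \<Rightarrow> ('i \<Rightarrow> 'i \<Rightarrow> bool) \<Rightarrow> ('i \<Rightarrow> 's set) \<Rightarrow> bool" where
  "right_Folner_net S I leq F \<longleftrightarrow>
     directed_preorder I leq \<and>
     (\<forall>i\<in>I. finite (F i) \<and> F i \<noteq> {} \<and> F i \<subseteq> carrier S) \<and>
     (\<forall>s\<in>carrier S.
        ((\<lambda>i. real (card ((F i #>\<^bsub>S\<^esub> s) - F i)) / real (card (F i))) \<longlongrightarrow> 0)
          (INF i0\<in>I. principal {i\<in>I. leq i0 i}))"

text \<open>
  The group of left fractions is determined up to an isomorphism compatible with the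
  embedding \<open>\<iota>\<close>, so it is given by the properties that define it.
\<close>

definition group_of_left_fractions ::
  "('s, 'm) monoid_scheme \<Rightarrow> ('g, 'n) monoid_scheme \<Rightarrow> ('s \<Rightarrow> 'g) \<Rightarrow> bool" where
  "group_of_left_fractions S G \<iota> \<longleftrightarrow>
     group G \<and> \<iota> \<in> hom S G \<and> inj_on \<iota> (carrier S) \<and>
     carrier G = {inv\<^bsub>G\<^esub> (\<iota> s) \<otimes>\<^bsub>G\<^esub> \<iota> t | s t. s \<in> carrier S \<and> t \<in> carrier S}"

definition fraction_le ::
  "('s, 'm) monoid_scheme \<Rightarrow> ('g, 'n) monoid_scheme \<Rightarrow> ('s \<Rightarrow> 'g) \<Rightarrow> 'g \<Rightarrow> 'g \<Rightarrow> bool" where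
  "fraction_le S G \<iota> g1 g2 \<longleftrightarrow> inv\<^bsub>G\<^esub> g2 \<otimes>\<^bsub>G\<^esub> g1 \<in> \<iota> ` carrier S"

definition right_action ::
  "('s, 'm) monoid_scheme \<Rightarrow> 'a topology \<Rightarrow> ('s \<Rightarrow> 'a \<Rightarrow> 'a) \<Rightarrow> bool" where
  "right_action S K \<rho> \<longleftrightarrow>
     (\<forall>s\<in>carrier S. continuous_map K K (\<rho> s)) \<and>
     (\<forall>x\<in>topspace K. \<rho> \<one>\<^bsub>S\<^esub> x = x) \<and>
     (\<forall>s\<in>carrier S. \<forall>t\<in>carrier S. \<forall>x\<in>topspace K. \<rho> (s \<otimes>\<^bsub>S\<^esub> t) x = \<rho> t (\<rho> s x))"

definition equivariant ::
  "('s, 'm) monoid_scheme \<Rightarrow> 'a topology \<Rightarrow> ('s \<Rightarrow> 'a \<Rightarrow> 'a) \<Rightarrow> ('s \<Rightarrow> 'b \<Rightarrow> 'b) \<Rightarrow> ('a \<Rightarrow> 'b) \<Rightarrow> bool" where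
  "equivariant S K \<rho> \<rho>' \<phi> \<longleftrightarrow>
     (\<forall>s\<in>carrier S. \<forall>x\<in>topspace K. \<phi> (\<rho> s x) = \<rho>' s (\<phi> x))"

definition core ::
  "('s, 'm) monoid_scheme \<Rightarrow> 'a topology \<Rightarrow> ('s \<Rightarrow> 'a \<Rightarrow> 'a) \<Rightarrow> 'a set" where
  "core S K \<rho> = (\<Inter>t\<in>carrier S. \<rho> t ` topspace K)"

definition core_space ::
  "('s, 'm) monoid_scheme \<Rightarrow> 'a topology \<Rightarrow> ('s \<Rightarrow> 'a \<Rightarrow> 'a) \<Rightarrow> 'a topology" where
  "core_space S K \<rho> = subtopology K (core S K \<rho>)"

definition core_action ::
  "('s, 'm) monoid_scheme \<Rightarrow> 'a topology \<Rightarrow> ('s \<Rightarrow> 'a \<Rightarrow> 'a) \<Rightarrow> 's \<Rightarrow> 'a \<Rightarrow> 'a" where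
  "core_action S K \<rho> s = restrict (\<rho> s) (core S K \<rho>)"

text \<open>For \<open>leq i j\<close>, the transition map \<open>f j i\<close> goes from \<open>X j\<close> to \<open>X i\<close>.\<close>

definition inverse_limit ::
  "'i set \<Rightarrow> ('i \<Rightarrow> 'i \<Rightarrow> bool) \<Rightarrow> ('i \<Rightarrow> 'a topology) \<Rightarrow> ('i \<Rightarrow> 'i \<Rightarrow> 'a \<Rightarrow> 'a)
    \<Rightarrow> ('i \<Rightarrow> 'a) topology" where
  "inverse_limit I leq X f =
     subtopology (product_topology X I)
       {x. \<forall>i\<in>I. \<forall>j\<in>I. leq i j \<longrightarrow> f j i (x j) = x i}"

definition limit_proj :: "'i \<Rightarrow> ('i \<Rightarrow> 'a) \<Rightarrow> 'a" where
  "limit_proj i x = x i"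

text \<open>
  If \<open>fraction_le S G \<iota> h g\<close>, then \<open>h = g s\<close> for a unique \<open>s\<close> in \<open>S\<close>, namely the preimage
  of \<open>g\<inverse> h\<close> under \<open>\<iota>\<close>; see the lemma \<open>transition_right_mult\<close>.
\<close>

definition transition ::
  "('s, 'm) monoid_scheme \<Rightarrow> ('g, 'n) monoid_scheme \<Rightarrow> ('s \<Rightarrow> 'g) \<Rightarrow> 'a topology \<Rightarrow>
    ('s \<Rightarrow> 'a \<Rightarrow> 'a) \<Rightarrow> 'g \<Rightarrow> 'g \<Rightarrow> 'a \<Rightarrow> 'a" where
  "transition S G \<iota> K \<rho> g h =
     core_action S K \<rho> (inv_into (carrier S) \<iota> (inv\<^bsub>G\<^esub> g \<otimes>\<^bsub>G\<^esub> h))"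

lemma transition_right_mult:
  assumes "group_of_left_fractions S G \<iota>" "g \<in> carrier G" "s \<in> carrier S"
  shows "fraction_le S G \<iota> (g \<otimes>\<^bsub>G\<^esub> \<iota> s) g"
    and "transition S G \<iota> K \<rho> g (g \<otimes>\<^bsub>G\<^esub> \<iota> s) = core_action S K \<rho> s"
proof -
  interpret G: group G using assms(1) by (simp add: group_of_left_fractions_def)
  have "\<iota> s \<in> carrier G"
    using assms(1,3) by (auto simp: group_of_left_fractions_def hom_def)
  then have *: "inv\<^bsub>G\<^esub> g \<otimes>\<^bsub>G\<^esub> (g \<otimes>\<^bsub>G\<^esub> \<iota> s) = \<iota> s"
    using assms(2) by (simp flip: G.m_assoc)
  show "fraction_le S G \<iota> (g \<otimes>\<^bsub>G\<^esub> \<iota> s) g"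
    using assms(3) by (simp add: fraction_le_def *)
  show "transition S G \<iota> K \<rho> g (g \<otimes>\<^bsub>G\<^esub> \<iota> s) = core_action S K \<rho> s"
    using assms(1,3) by (simp add: transition_def * group_of_left_fractions_def)
qed

definition star_space ::
  "('s, 'm) monoid_scheme \<Rightarrow> ('g, 'n) monoid_scheme \<Rightarrow> ('s \<Rightarrow> 'g) \<Rightarrow> 'a topology \<Rightarrow>
    ('s \<Rightarrow> 'a \<Rightarrow> 'a) \<Rightarrow> ('g \<Rightarrow> 'a) topology" where
  "star_space S G \<iota> K \<rho> =
     inverse_limit (carrier G) (fraction_le S G \<iota>) (\<lambda>_. core_space S K \<rho>) (transition S G \<iota> K \<rho>)"

text \<open>
  HOL functions are total, so a map out of a space is unique only up to its values outside the
  space; these values are normalised by \<^const>\<open>extensional\<close>.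
\<close>

definition is_star_shift ::
  "('s, 'm) monoid_scheme \<Rightarrow> ('g, 'n) monoid_scheme \<Rightarrow> ('s \<Rightarrow> 'g) \<Rightarrow> 'a topology \<Rightarrow>
    ('s \<Rightarrow> 'a \<Rightarrow> 'a) \<Rightarrow> 'g \<Rightarrow> (('g \<Rightarrow> 'a) \<Rightarrow> 'g \<Rightarrow> 'a) \<Rightarrow> bool" where
  "is_star_shift S G \<iota> K \<rho> g r \<longleftrightarrow>
     r \<in> extensional (topspace (star_space S G \<iota> K \<rho>)) \<and>
     continuous_map (star_space S G \<iota> K \<rho>) (star_space S G \<iota> K \<rho>) r \<and>
     (\<forall>h\<in>carrier G. \<forall>x\<in>topspace (star_space S G \<iota> K \<rho>).
        limit_proj h (r x) = limit_proj (g \<otimes>\<^bsub>G\<^esub> h) x)"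

definition star_action ::
  "('s, 'm) monoid_scheme \<Rightarrow> ('g, 'n) monoid_scheme \<Rightarrow> ('s \<Rightarrow> 'g) \<Rightarrow> 'a topology \<Rightarrow>
    ('s \<Rightarrow> 'a \<Rightarrow> 'a) \<Rightarrow> 'g \<Rightarrow> ('g \<Rightarrow> 'a) \<Rightarrow> 'g \<Rightarrow> 'a" where
  "star_action S G \<iota> K \<rho> g = (THE r. is_star_shift S G \<iota> K \<rho> g r)"

definition is_star_map ::
  "('s, 'm) monoid_scheme \<Rightarrow> ('g, 'n) monoid_scheme \<Rightarrow> ('s \<Rightarrow> 'g) \<Rightarrow>
    'a topology \<Rightarrow> ('s \<Rightarrow> 'a \<Rightarrow> 'a) \<Rightarrow> 'b topology \<Rightarrow> ('s \<Rightarrow> 'b \<Rightarrow> 'b) \<Rightarrow> ('a \<Rightarrow> 'b) \<Rightarrow>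
    (('g \<Rightarrow> 'a) \<Rightarrow> 'g \<Rightarrow> 'b) \<Rightarrow> bool" where
  "is_star_map S G \<iota> K \<rho> K' \<rho>' \<phi> f \<longleftrightarrow>
     f \<in> extensional (topspace (star_space S G \<iota> K \<rho>)) \<and>
     continuous_map (star_space S G \<iota> K \<rho>) (star_space S G \<iota> K' \<rho>') f \<and>
     (\<forall>g\<in>carrier G. \<forall>x\<in>topspace (star_space S G \<iota> K \<rho>).
        limit_proj g (f x) = restrict \<phi> (core S K \<rho>) (limit_proj g x))"

definition star_map ::
  "('s, 'm) monoid_scheme \<Rightarrow> ('g, 'n) monoid_scheme \<Rightarrow> ('s \<Rightarrow> 'g) \<Rightarrow>
    'a topology \<Rightarrow> ('s \<Rightarrow> 'a \<Rightarrow> 'a) \<Rightarrow> 'b topology \<Rightarrow> ('s \<Rightarrow> 'b \<Rightarrow> 'b) \<Rightarrow> ('a \<Rightarrow> 'b) \<Rightarrow>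
    ('g \<Rightarrow> 'a) \<Rightarrow> 'g \<Rightarrow> 'b" where
  "star_map S G \<iota> K \<rho> K' \<rho>' \<phi> = (THE f. is_star_map S G \<iota> K \<rho> K' \<rho>' \<phi> f)"

end

theory Submission imports Defs begin

text \<open>
  That every element of \<open>G\<close> is a left fraction gives both the left Ore condition and directedness
  of \<open>\<le>\<^sub>S\<close>: if \<open>g\<inverse> h = s\<inverse> t\<close>, then \<open>g s\<inverse>\<close> is an upper bound of \<open>g\<close> and \<open>h\<close>. By the Ore
  condition the sets \<open>\<rho>\<^sub>t(K)\<close> form a directed family, so compactness shows that \<open>\<rho>\<^sub>s\<close> maps the core
  onto itself and that a surjective \<open>\<phi>\<close> maps the core onto the core. The surjectivity of \<open>\<pi>\<^sub>g\<close>
  and of \<open>\<phi>\<^sup>*\<close> is then the non-emptiness of the inverse limit of the (compact, non-empty) fibres.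
  All other claims are checked coordinatewise.
\<close>

section \<open>Directed intersections and inverse limits of compact spaces\<close>

text \<open>Directedness puts a single member \<open>C k\<close> inside any finite subfamily, so the
  finite intersection property reduces to non-emptiness of the individual members.\<close>

lemma compact_directed_Inter_nonempty:
  assumes "compact_space X" "I \<noteq> {}"
    and closed: "\<And>i. i \<in> I \<Longrightarrow> closedin X (C i)"
    and nonempty: "\<And>i. i \<in> I \<Longrightarrow> C i \<noteq> {}"
    and directed: "\<And>i j. i \<in> I \<Longrightarrow> j \<in> I \<Longrightarrow> \<exists>k\<in>I. C k \<subseteq> C i \<inter> C j"
  shows "(\<Inter>i\<in>I. C i) \<noteq> {}"
proof -
  have lower: "\<exists>k\<in>I. \<forall>i\<in>J. C k \<subseteq> C i" if "finite J" "J \<subseteq> I" for J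
    using that
  proof (induction J)
    case empty
    then show ?case using \<open>I \<noteq> {}\<close> by auto
  next
    case (insert j J)
    then obtain k where k: "k \<in> I" "\<forall>i\<in>J. C k \<subseteq> C i" by auto
    have "j \<in> I" using insert.prems by simp
    from directed[OF this k(1)] obtain l where l: "l \<in> I" "C l \<subseteq> C j" "C l \<subseteq> C k" by auto
    with k(2) have "\<forall>i\<in>insert j J. C l \<subseteq> C i" by auto
    with l(1) show ?case ..
  qed
  have "\<Inter>\<F> \<noteq> {}" if fin: "finite \<F>" "\<F> \<subseteq> C ` I" for \<F>
  proof -
    obtain J where J: "J \<subseteq> I" "finite J" "\<F> = C ` J"
      using finite_subset_image[OF fin] by metis
    then obtain k where k: "k \<in> I" "\<forall>i\<in>J. C k \<subseteq> C i"
      using lower by metis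
    obtain x where "x \<in> C k" using nonempty[OF k(1)] by auto
    with k J(3) have "x \<in> \<Inter>\<F>" by auto
    then show ?thesis by force
  qed
  moreover have "\<forall>D\<in>C ` I. closedin X D" using closed by simp
  ultimately show ?thesis
    using \<open>compact_space X\<close> unfolding compact_space_fip by simp
qed

text \<open>The limit is the intersection over \<open>k\<close> of the sets of families in the
  product that are compatible with every transition out of \<open>k\<close>. These sets are closed,
  non-empty and shrink as \<open>k\<close> grows, so the previous lemma applies in the compact
  product.\<close>

lemma inverse_limit_nonempty:
  assumes dir: "directed_preorder I leq"
    and compact: "\<And>i. i \<in> I \<Longrightarrow> compact_space (X i)"
    and Hausdorff: "\<And>i. i \<in> I \<Longrightarrow> Hausdorff_space (X i)"
    and nonempty: "\<And>i. i \<in> I \<Longrightarrow> topspace (X i) \<noteq> {}"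
    and cont: "\<And>i j. i \<in> I \<Longrightarrow> j \<in> I \<Longrightarrow> leq i j \<Longrightarrow> continuous_map (X j) (X i) (f j i)"
    and id: "\<And>i x. i \<in> I \<Longrightarrow> x \<in> topspace (X i) \<Longrightarrow> f i i x = x"
    and comp: "\<And>i j k x. \<lbrakk>i \<in> I; j \<in> I; k \<in> I; leq i j; leq j k; x \<in> topspace (X k)\<rbrakk>
                 \<Longrightarrow> f j i (f k j x) = f k i x"
  shows "topspace (inverse_limit I leq X f) \<noteq> {}"
proof -
  have refl: "leq i i" if "i \<in> I" for i
    using dir that unfolding directed_preorder_def by blast
  have trans: "leq i k" if "i \<in> I" "j \<in> I" "k \<in> I" "leq i j" "leq j k" for i j k
    using dir that unfolding directed_preorder_def by blast
  have upper: "\<exists>k\<in>I. leq i k \<and> leq j k" if "i \<in> I" "j \<in> I" for i j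
    using dir that unfolding directed_preorder_def by blast
  define P where "P = product_topology X I"
  \<comment> \<open>Only the transitions starting at \<open>k\<close> are imposed. A point of
    \<open>C k\<close> can thus be built from one element of \<open>X k\<close>, whereas
    compatibility between all pairs is obtained only in the intersection.\<close>
  define C where "C k = {x \<in> topspace P. \<forall>i\<in>I. leq i k \<longrightarrow> f k i (x k) = x i}" for k
  have proj: "continuous_map P (X i) (\<lambda>x. x i)" if "i \<in> I" for i
    unfolding P_def using that by (rule continuous_map_product_projection)
  have coord: "x i \<in> topspace (X i)" if "x \<in> topspace P" "i \<in> I" for x i
    using that by (auto simp: P_def)
  have "(\<Inter>k\<in>I. C k) \<noteq> {}"
  proof (rule compact_directed_Inter_nonempty)
    show "compact_space P"
      using compact by (simp add: P_def compact_space_product_topology)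
    show "I \<noteq> {}"
      using dir by (simp add: directed_preorder_def)
  next
    fix k assume k: "k \<in> I"
    \<comment> \<open>Each set on the right is an equaliser of two continuous maps into a Hausdorff
      space. Reflexivity puts \<open>k\<close> itself among the \<open>i\<close>, so the
      intersection is over a non-empty family and stays inside \<open>topspace P\<close>.\<close>
    have eq: "C k = (\<Inter>i\<in>{i\<in>I. leq i k}. {x \<in> topspace P. f k i (x k) = x i})"
      using k refl by (auto simp: C_def)
    show "closedin P (C k)"
      unfolding eq
    proof (rule closedin_INT)
      show "{i \<in> I. leq i k} \<noteq> {}" using k refl by auto
    next
      fix i assume i: "i \<in> {i \<in> I. leq i k}"
      have "continuous_map P (X i) (f k i \<circ> (\<lambda>x. x k))"
        using i k by (intro continuous_map_compose[OF proj cont]) auto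
      then have "continuous_map P (X i) (\<lambda>x. f k i (x k))" by (simp add: o_def)
      then show "closedin P {x \<in> topspace P. f k i (x k) = x i}"
        using i Hausdorff proj by (intro closedin_continuous_maps_eq[of "X i"]) auto
    qed
    obtain a where a: "a \<in> topspace (X k)" using nonempty[OF k] by blast
    have "\<forall>i\<in>I. \<exists>y. y \<in> topspace (X i)" using nonempty by blast
    then obtain b where b: "\<And>i. i \<in> I \<Longrightarrow> b i \<in> topspace (X i)" by metis
    \<comment> \<open>Below \<open>k\<close> the element \<open>a\<close> is pushed along the
      transitions; elsewhere the coordinates are arbitrary. The coordinate at \<open>k\<close> is
      \<open>f k k a = a\<close>, which makes the condition of \<open>C k\<close> hold.\<close>
    define x where "x = restrict (\<lambda>i. if leq i k then f k i a else b i) I"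
    have "f k i a \<in> topspace (X i)" if "i \<in> I" "leq i k" for i
      using continuous_map_funspace[OF cont[OF that(1) k that(2)]] a by auto
    then have "x \<in> C k"
      using k refl id[OF k a] b by (auto simp: C_def P_def x_def)
    then show "C k \<noteq> {}" by blast
  next
    \<comment> \<open>For \<open>i\<close> below \<open>j\<close> below \<open>k\<close>,
      composition of transitions gives
      \<open>f j i (x j) = f j i (f k j (x k)) = f k i (x k) = x i\<close>.\<close>
    have mono: "C k \<subseteq> C j" if "j \<in> I" "k \<in> I" "leq j k" for j k
    proof
      fix x assume x: "x \<in> C k"
      then have "f j i (x j) = x i" if "i \<in> I" "leq i j" for i
        using comp[of i j k "x k"] trans[of i j k] coord[of x k] that \<open>j \<in> I\<close> \<open>k \<in> I\<close> \<open>leq j k\<close>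
        by (auto simp: C_def)
      with x show "x \<in> C j" by (auto simp: C_def)
    qed
    fix i j assume ij: "i \<in> I" "j \<in> I"
    then obtain k where "k \<in> I" "leq i k" "leq j k" using upper by blast
    with ij mono show "\<exists>k\<in>I. C k \<subseteq> C i \<inter> C j" by (meson le_infI)
  qed
  then obtain x where x: "\<And>k. k \<in> I \<Longrightarrow> x \<in> C k" by blast
  obtain i where "i \<in> I" using dir unfolding directed_preorder_def by blast
  from x[OF this] have "x \<in> topspace P" unfolding C_def by blast
  moreover have "f j i (x j) = x i" if "i \<in> I" "j \<in> I" "leq i j" for i j
    using x[OF that(2)] that unfolding C_def by blast
  ultimately have "x \<in> topspace (inverse_limit I leq X f)"
    by (simp add: inverse_limit_def P_def)
  then show ?thesis by blast
qed

section \<open>Left fractions, the Ore condition and the directed preorder\<close>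

locale left_fractions = S: monoid S + G: group G
  for S :: "('s, 'm) monoid_scheme" and G :: "('g, 'n) monoid_scheme" and \<iota> :: "'s \<Rightarrow> 'g" +
  assumes fractions: "group_of_left_fractions S G \<iota>"
begin

lemma embedding_hom: "\<iota> \<in> hom S G"
  and embedding_inj: "inj_on \<iota> (carrier S)"
  and carrier_fractions:
    "carrier G = {inv\<^bsub>G\<^esub> (\<iota> s) \<otimes>\<^bsub>G\<^esub> \<iota> t | s t. s \<in> carrier S \<and> t \<in> carrier S}"
  using fractions unfolding group_of_left_fractions_def by simp_all

lemma embedding_closed [simp]: "s \<in> carrier S \<Longrightarrow> \<iota> s \<in> carrier G"
  by (rule hom_in_carrier[OF embedding_hom])

lemma embedding_mult: "s \<in> carrier S \<Longrightarrow> t \<in> carrier S \<Longrightarrow> \<iota> (s \<otimes>\<^bsub>S\<^esub> t) = \<iota> s \<otimes>\<^bsub>G\<^esub> \<iota> t"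
  by (rule hom_mult[OF embedding_hom])

text \<open>Membership in \<open>hom\<close> speaks of products only; the unit goes to an
  idempotent, and the only idempotent of a group is its unit.\<close>

lemma embedding_one: "\<iota> \<one>\<^bsub>S\<^esub> = \<one>\<^bsub>G\<^esub>"
  using embedding_mult[of "\<one>\<^bsub>S\<^esub>" "\<one>\<^bsub>S\<^esub>"] by (simp add: G.l_cancel_one')

lemma fractionE:
  assumes "g \<in> carrier G"
  obtains s t where "s \<in> carrier S" "t \<in> carrier S" "g = inv\<^bsub>G\<^esub> (\<iota> s) \<otimes>\<^bsub>G\<^esub> \<iota> t"
  using assms that unfolding carrier_fractions by blast

text \<open>The quotient of \<open>\<iota> s\<close> by \<open>\<iota> t\<close>, with the inverse
  on the right, is rewritten as a left fraction with denominator \<open>\<iota> a\<close> and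
  numerator \<open>\<iota> b\<close>. Clearing both denominators gives the equation in
  \<open>G\<close>, and injectivity of \<open>\<iota>\<close> brings it back to
  \<open>S\<close>.\<close>

lemma left_Ore:
  assumes "s \<in> carrier S" "t \<in> carrier S"
  obtains a b where "a \<in> carrier S" "b \<in> carrier S" "a \<otimes>\<^bsub>S\<^esub> s = b \<otimes>\<^bsub>S\<^esub> t"
proof -
  obtain a b where ab: "a \<in> carrier S" "b \<in> carrier S"
      "\<iota> s \<otimes>\<^bsub>G\<^esub> inv\<^bsub>G\<^esub> (\<iota> t) = inv\<^bsub>G\<^esub> (\<iota> a) \<otimes>\<^bsub>G\<^esub> \<iota> b"
    using fractionE[of "\<iota> s \<otimes>\<^bsub>G\<^esub> inv\<^bsub>G\<^esub> (\<iota> t)"] assms by auto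
  have "\<iota> a \<otimes>\<^bsub>G\<^esub> \<iota> s = \<iota> a \<otimes>\<^bsub>G\<^esub> (\<iota> s \<otimes>\<^bsub>G\<^esub> inv\<^bsub>G\<^esub> (\<iota> t)) \<otimes>\<^bsub>G\<^esub> \<iota> t"
    using assms ab(1,2) by (simp add: G.m_assoc)
  also have "\<dots> = \<iota> b \<otimes>\<^bsub>G\<^esub> \<iota> t"
    unfolding ab(3) using assms ab(1,2) by (simp flip: G.m_assoc)
  finally have "\<iota> (a \<otimes>\<^bsub>S\<^esub> s) = \<iota> (b \<otimes>\<^bsub>S\<^esub> t)"
    using assms ab by (simp add: embedding_mult)
  then have "a \<otimes>\<^bsub>S\<^esub> s = b \<otimes>\<^bsub>S\<^esub> t"
    using embedding_inj assms ab by (meson S.m_closed inj_onD)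
  with ab that show thesis by blast
qed

text \<open>Right multiplication by \<open>S\<close> moves down in the preorder, so the indices
  above \<open>g\<close> are those from which \<open>g\<close> is reached by such a
  multiplication.\<close>

lemma fraction_le_iff:
  assumes "g \<in> carrier G" "h \<in> carrier G"
  shows "fraction_le S G \<iota> h g \<longleftrightarrow> (\<exists>s\<in>carrier S. h = g \<otimes>\<^bsub>G\<^esub> \<iota> s)"
proof
  assume "fraction_le S G \<iota> h g"
  then obtain s where s: "s \<in> carrier S" "inv\<^bsub>G\<^esub> g \<otimes>\<^bsub>G\<^esub> h = \<iota> s"
    by (auto simp: fraction_le_def)
  then have "h = g \<otimes>\<^bsub>G\<^esub> \<iota> s"
    using assms by (metis G.inv_solve_left embedding_closed)
  with s show "\<exists>s\<in>carrier S. h = g \<otimes>\<^bsub>G\<^esub> \<iota> s" by blast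
qed (use transition_right_mult(1)[OF fractions] assms in auto)

lemma fraction_le_refl: "g \<in> carrier G \<Longrightarrow> fraction_le S G \<iota> g g"
  using embedding_one by (force simp: fraction_le_iff)

lemma fraction_le_trans:
  assumes "g \<in> carrier G" "h \<in> carrier G" "k \<in> carrier G"
    and "fraction_le S G \<iota> g h" "fraction_le S G \<iota> h k"
  shows "fraction_le S G \<iota> g k"
proof -
  obtain s t where st: "s \<in> carrier S" "t \<in> carrier S" "g = h \<otimes>\<^bsub>G\<^esub> \<iota> s" "h = k \<otimes>\<^bsub>G\<^esub> \<iota> t"
    using assms by (auto simp: fraction_le_iff)
  then have "g = k \<otimes>\<^bsub>G\<^esub> \<iota> (t \<otimes>\<^bsub>S\<^esub> s)"
    using assms(3) by (simp add: embedding_mult G.m_assoc)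
  with st assms show ?thesis
    using fraction_le_iff S.m_closed by blast
qed

lemma directed_fraction_le: "directed_preorder (carrier G) (fraction_le S G \<iota>)"
  unfolding directed_preorder_def
proof (intro conjI ballI impI)
  fix g h assume gh: "g \<in> carrier G" "h \<in> carrier G"
  obtain s t where st: "s \<in> carrier S" "t \<in> carrier S"
      "inv\<^bsub>G\<^esub> g \<otimes>\<^bsub>G\<^esub> h = inv\<^bsub>G\<^esub> (\<iota> s) \<otimes>\<^bsub>G\<^esub> \<iota> t"
    using fractionE[of "inv\<^bsub>G\<^esub> g \<otimes>\<^bsub>G\<^esub> h"] gh by auto
  define k where "k = g \<otimes>\<^bsub>G\<^esub> inv\<^bsub>G\<^esub> (\<iota> s)"
  have k: "k \<in> carrier G" using gh st by (simp add: k_def)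
  have "g = k \<otimes>\<^bsub>G\<^esub> \<iota> s"
    using gh st by (simp add: k_def G.m_assoc)
  moreover have "h = k \<otimes>\<^bsub>G\<^esub> \<iota> t"
  proof -
    have "h = g \<otimes>\<^bsub>G\<^esub> (inv\<^bsub>G\<^esub> g \<otimes>\<^bsub>G\<^esub> h)"
      using gh by (simp flip: G.m_assoc)
    also have "\<dots> = k \<otimes>\<^bsub>G\<^esub> \<iota> t"
      unfolding st(3) k_def using gh st by (simp add: G.m_assoc)
    finally show ?thesis .
  qed
  ultimately show "\<exists>k\<in>carrier G. fraction_le S G \<iota> g k \<and> fraction_le S G \<iota> h k"
    using k st gh fraction_le_iff by blast
qed (use fraction_le_refl fraction_le_trans in blast)+

end

section \<open>The core of an action on a compact space\<close>

locale compact_right_action = left_fractions S G \<iota>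
  for S :: "('s, 'm) monoid_scheme" and G :: "('g, 'n) monoid_scheme" and \<iota> :: "'s \<Rightarrow> 'g" +
  fixes K :: "'a topology" and \<rho> :: "'s \<Rightarrow> 'a \<Rightarrow> 'a"
  assumes compact: "compact_space K" and Hausdorff: "Hausdorff_space K"
    and action: "right_action S K \<rho>"
begin

abbreviation "core_set \<equiv> core S K \<rho>"
abbreviation "star \<equiv> star_space S G \<iota> K \<rho>"

lemma action_continuous: "s \<in> carrier S \<Longrightarrow> continuous_map K K (\<rho> s)"
  and action_one: "x \<in> topspace K \<Longrightarrow> \<rho> \<one>\<^bsub>S\<^esub> x = x"
  and action_mult: "\<lbrakk>s \<in> carrier S; t \<in> carrier S; x \<in> topspace K\<rbrakk>
                      \<Longrightarrow> \<rho> (s \<otimes>\<^bsub>S\<^esub> t) x = \<rho> t (\<rho> s x)"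
  using action by (auto simp: right_action_def)

lemma action_closed: "s \<in> carrier S \<Longrightarrow> x \<in> topspace K \<Longrightarrow> \<rho> s x \<in> topspace K"
  using continuous_map_funspace[OF action_continuous] by auto

lemma core_subset: "core_set \<subseteq> topspace K"
proof
  fix x assume "x \<in> core_set"
  then have "x \<in> \<rho> \<one>\<^bsub>S\<^esub> ` topspace K" by (simp add: core_def)
  then show "x \<in> topspace K" by (auto simp: action_one)
qed

lemma topspace_core_space: "topspace (core_space S K \<rho>) = core_set"
  using core_subset by (auto simp: core_space_def)

lemma closedin_action_image: "t \<in> carrier S \<Longrightarrow> closedin K (\<rho> t ` topspace K)"
  using continuous_imp_closed_map[OF action_continuous compact Hausdorff]
  by (simp add: closed_map_def)

lemma closedin_core: "closedin K core_set"
  unfolding core_def using S.one_closed closedin_action_image by (intro closedin_INT) auto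

lemma compact_core: "compact_space (core_space S K \<rho>)"
  by (simp add: core_space_def closedin_compact_space compact closedin_core compact_space_subtopology)

lemma Hausdorff_core: "Hausdorff_space (core_space S K \<rho>)"
  by (simp add: core_space_def Hausdorff_space_subtopology Hausdorff)

text \<open>In a right action the last factor acts last, so the image of \<open>\<rho> (a s)\<close>
  lies in that of \<open>\<rho> s\<close>. A common left multiple \<open>a s = b t\<close> therefore
  makes the images directed downwards. The lemma is applied to fibres of \<open>\<rho> s\<close> and
  of an equivariant map.\<close>

lemma closed_meets_core:
  assumes "closedin K D" and meets: "\<And>t. t \<in> carrier S \<Longrightarrow> D \<inter> \<rho> t ` topspace K \<noteq> {}"
  shows "D \<inter> core_set \<noteq> {}"
proof -
  have "(\<Inter>t\<in>carrier S. D \<inter> \<rho> t ` topspace K) \<noteq> {}"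
  proof (rule compact_directed_Inter_nonempty[OF compact _ _ meets])
    fix s t assume st: "s \<in> carrier S" "t \<in> carrier S"
    then obtain a b where ab: "a \<in> carrier S" "b \<in> carrier S" "a \<otimes>\<^bsub>S\<^esub> s = b \<otimes>\<^bsub>S\<^esub> t"
      by (rule left_Ore)
    have "\<rho> (a \<otimes>\<^bsub>S\<^esub> s) ` topspace K \<subseteq> \<rho> s ` topspace K"
      using st ab(1) by (auto simp: action_mult action_closed)
    moreover have "\<rho> (b \<otimes>\<^bsub>S\<^esub> t) ` topspace K \<subseteq> \<rho> t ` topspace K"
      using st ab(2) by (auto simp: action_mult action_closed)
    ultimately show "\<exists>k\<in>carrier S. D \<inter> \<rho> k ` topspace K
        \<subseteq> (D \<inter> \<rho> s ` topspace K) \<inter> (D \<inter> \<rho> t ` topspace K)"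
      using st ab by (intro bexI[of _ "a \<otimes>\<^bsub>S\<^esub> s"]) auto
  qed (use S.one_closed assms(1) closedin_action_image in auto)
  moreover have "carrier S \<noteq> {}" using S.one_closed by blast
  ultimately show ?thesis by (simp add: core_def)
qed

text \<open>To reach the image of \<open>\<rho> t\<close>, choose \<open>a s = b t\<close> and write
  \<open>x = \<rho> a y\<close>, which is possible for a point of the core. Then
  \<open>\<rho> s x\<close> is the value of \<open>\<rho> (b t)\<close> at \<open>y\<close>.\<close>

lemma action_core_closed:
  assumes "s \<in> carrier S" "x \<in> core_set"
  shows "\<rho> s x \<in> core_set"
  unfolding core_def
proof
  fix t assume t: "t \<in> carrier S"
  obtain a b where ab: "a \<in> carrier S" "b \<in> carrier S" "a \<otimes>\<^bsub>S\<^esub> s = b \<otimes>\<^bsub>S\<^esub> t"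
    using assms(1) t by (rule left_Ore)
  obtain y where y: "y \<in> topspace K" "x = \<rho> a y" using assms(2) ab by (auto simp: core_def)
  then have "\<rho> s x = \<rho> (b \<otimes>\<^bsub>S\<^esub> t) y"
    using assms(1) ab action_mult by metis
  also have "\<dots> = \<rho> t (\<rho> b y)" using ab t y by (simp add: action_mult)
  finally show "\<rho> s x \<in> \<rho> t ` topspace K" using ab y by (auto simp: action_closed)
qed

lemma closedin_fibre:
  assumes "continuous_map K Y f" "Hausdorff_space Y" "y \<in> topspace Y"
  shows "closedin K {x \<in> topspace K. f x = y}"
  using closedin_continuous_map_preimage[OF assms(1), of "{y}"] assms(2,3)
  by (simp add: closedin_Hausdorff_singleton)

text \<open>The fibre of \<open>\<rho> s\<close> over \<open>y\<close> is closed. It meets every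
  image of \<open>\<rho> t\<close>, since \<open>y\<close> lies in the image of
  \<open>\<rho> (t s)\<close>; hence it meets the core.\<close>

lemma action_core_surj:
  assumes "s \<in> carrier S" "y \<in> core_set"
  obtains x where "x \<in> core_set" "\<rho> s x = y"
proof -
  have "{x \<in> topspace K. \<rho> s x = y} \<inter> core_set \<noteq> {}"
  proof (rule closed_meets_core)
    show "closedin K {x \<in> topspace K. \<rho> s x = y}"
      using assms core_subset by (intro closedin_fibre[OF action_continuous Hausdorff]) auto
  next
    fix t assume t: "t \<in> carrier S"
    then obtain z where z: "z \<in> topspace K" "y = \<rho> (t \<otimes>\<^bsub>S\<^esub> s) z"
      using assms by (auto simp: core_def)
    then have "\<rho> t z \<in> {x \<in> topspace K. \<rho> s x = y} \<inter> \<rho> t ` topspace K"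
      using assms(1) t by (auto simp: action_mult action_closed)
    then show "{x \<in> topspace K. \<rho> s x = y} \<inter> \<rho> t ` topspace K \<noteq> {}"
      by (metis empty_iff)
  qed
  with that show thesis by auto
qed

lemma core_action_continuous:
  assumes "s \<in> carrier S"
  shows "continuous_map (core_space S K \<rho>) (core_space S K \<rho>) (core_action S K \<rho> s)"
proof -
  have "continuous_map (core_space S K \<rho>) (core_space S K \<rho>) (\<rho> s)"
    unfolding core_space_def continuous_map_in_subtopology
    using assms action_core_closed
    by (auto intro: continuous_map_from_subtopology action_continuous)
  then show ?thesis
    by (rule continuous_map_eq) (simp add: topspace_core_space core_action_def)
qed

section \<open>The limit space and points with prescribed coordinates\<close>

text \<open>Every comparable pair of indices has the form \<open>g s\<close>, \<open>g\<close>, and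
  its transition is \<open>\<rho> s\<close> on the core. This removes \<open>transition\<close>, and
  the choice of a preimage under \<open>\<iota>\<close> hidden in it, from the description of
  points.\<close>

lemma star_iff:
  "x \<in> topspace star \<longleftrightarrow> x \<in> carrier G \<rightarrow>\<^sub>E core_set \<and>
     (\<forall>g\<in>carrier G. \<forall>s\<in>carrier S. x (g \<otimes>\<^bsub>G\<^esub> \<iota> s) = \<rho> s (x g))"
proof -
  have "(\<forall>i\<in>carrier G. \<forall>j\<in>carrier G. fraction_le S G \<iota> i j \<longrightarrow> transition S G \<iota> K \<rho> j i (x j) = x i)
      \<longleftrightarrow> (\<forall>g\<in>carrier G. \<forall>s\<in>carrier S. core_action S K \<rho> s (x g) = x (g \<otimes>\<^bsub>G\<^esub> \<iota> s))"
  proof (intro iffI ballI impI)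
    fix g s
    assume *: "\<forall>i\<in>carrier G. \<forall>j\<in>carrier G. fraction_le S G \<iota> i j
        \<longrightarrow> transition S G \<iota> K \<rho> j i (x j) = x i"
      and gs: "g \<in> carrier G" "s \<in> carrier S"
    then have "transition S G \<iota> K \<rho> g (g \<otimes>\<^bsub>G\<^esub> \<iota> s) (x g) = x (g \<otimes>\<^bsub>G\<^esub> \<iota> s)"
      using transition_right_mult(1)[OF fractions] by simp
    then show "core_action S K \<rho> s (x g) = x (g \<otimes>\<^bsub>G\<^esub> \<iota> s)"
      by (simp add: transition_right_mult(2)[OF fractions gs])
  next
    fix i j
    assume *: "\<forall>g\<in>carrier G. \<forall>s\<in>carrier S. core_action S K \<rho> s (x g) = x (g \<otimes>\<^bsub>G\<^esub> \<iota> s)"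
      and ij: "i \<in> carrier G" "j \<in> carrier G" "fraction_le S G \<iota> i j"
    then obtain s where "s \<in> carrier S" "i = j \<otimes>\<^bsub>G\<^esub> \<iota> s" by (auto simp: fraction_le_iff)
    with * ij(2) show "transition S G \<iota> K \<rho> j i (x j) = x i"
      by (simp add: transition_right_mult(2)[OF fractions])
  qed
  moreover have "x \<in> carrier G \<rightarrow>\<^sub>E core_set \<Longrightarrow> g \<in> carrier G \<Longrightarrow> core_action S K \<rho> s (x g) = \<rho> s (x g)"
    for g s
    by (auto simp: core_action_def PiE_iff)
  ultimately show ?thesis
    by (auto simp: star_space_def inverse_limit_def topspace_core_space)
qed

lemma star_core: "x \<in> topspace star \<Longrightarrow> g \<in> carrier G \<Longrightarrow> x g \<in> core_set"
  by (auto simp: star_iff)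

lemma star_eqI:
  "\<lbrakk>x \<in> topspace star; y \<in> topspace star; \<And>g. g \<in> carrier G \<Longrightarrow> x g = y g\<rbrakk> \<Longrightarrow> x = y"
  unfolding star_iff by (blast intro: PiE_ext)

lemma continuous_map_limit_proj:
  "g \<in> carrier G \<Longrightarrow> continuous_map star (core_space S K \<rho>) (\<lambda>x. x g)"
  unfolding star_space_def inverse_limit_def
  by (intro continuous_map_from_subtopology continuous_map_product_projection)

text \<open>The limit carries the subspace topology of a product, in which continuity is tested
  coordinatewise.\<close>

lemma continuous_map_into_star:
  assumes "\<And>g. g \<in> carrier G \<Longrightarrow> continuous_map X (core_space S K \<rho>) (\<lambda>x. f x g)"
    and "f ` topspace X \<subseteq> topspace star"
  shows "continuous_map X star f"
proof -
  have "continuous_map X (product_topology (\<lambda>_. core_space S K \<rho>) (carrier G)) f"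
    unfolding continuous_map_componentwise using assms by (auto simp: star_iff PiE_iff)
  then show ?thesis
    using assms(2) unfolding star_space_def inverse_limit_def
    by (auto simp: continuous_map_in_subtopology)
qed

lemma transition_fraction_leE:
  assumes "g \<in> carrier G" "h \<in> carrier G" "fraction_le S G \<iota> h g"
  obtains s where "s \<in> carrier S" "h = g \<otimes>\<^bsub>G\<^esub> \<iota> s"
    "transition S G \<iota> K \<rho> g h = core_action S K \<rho> s"
  using assms that transition_right_mult(2)[OF fractions] by (metis fraction_le_iff)

text \<open>The sets \<open>D g\<close> form a subsystem of non-empty compact Hausdorff spaces,
  whose limit is non-empty and sits inside the star space. With fibres for \<open>D g\<close> this
  yields the surjectivity both of the projections and of the induced maps.\<close>

lemma star_through_closed_sets:
  assumes closed: "\<And>g. g \<in> carrier G \<Longrightarrow> closedin (core_space S K \<rho>) (D g)"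
    and nonempty: "\<And>g. g \<in> carrier G \<Longrightarrow> D g \<noteq> {}"
    and maps: "\<And>g s x. \<lbrakk>g \<in> carrier G; s \<in> carrier S; x \<in> D g\<rbrakk> \<Longrightarrow> \<rho> s x \<in> D (g \<otimes>\<^bsub>G\<^esub> \<iota> s)"
  shows "\<exists>x\<in>topspace star. \<forall>g\<in>carrier G. x g \<in> D g"
proof -
  define X where "X g = subtopology (core_space S K \<rho>) (D g)" for g
  have D_core: "D g \<subseteq> core_set" if "g \<in> carrier G" for g
    using closedin_subset[OF closed[OF that]] by (simp add: topspace_core_space)
  then have top: "topspace (X g) = D g" if "g \<in> carrier G" for g
    using that by (auto simp: X_def topspace_core_space)
  have "topspace (inverse_limit (carrier G) (fraction_le S G \<iota>) X (transition S G \<iota> K \<rho>)) \<noteq> {}"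
  proof (rule inverse_limit_nonempty[OF directed_fraction_le])
    fix g assume g: "g \<in> carrier G"
    show "compact_space (X g)"
      unfolding X_def
      using compact_core closed[OF g] by (simp add: closedin_compact_space compact_space_subtopology)
    show "Hausdorff_space (X g)"
      by (simp add: X_def Hausdorff_core Hausdorff_space_subtopology)
    show "topspace (X g) \<noteq> {}" using g top nonempty by auto
    show "transition S G \<iota> K \<rho> g g x = x" if "x \<in> topspace (X g)" for x
    proof -
      have "x \<in> core_set" using that top D_core g by auto
      moreover have "transition S G \<iota> K \<rho> g g = core_action S K \<rho> \<one>\<^bsub>S\<^esub>"
        using transition_right_mult(2)[OF fractions g S.one_closed] g by (simp add: embedding_one)
      ultimately show ?thesis
        using core_subset by (auto simp: core_action_def action_one)
    qed
  next
    fix h g assume gh: "h \<in> carrier G" "g \<in> carrier G" "fraction_le S G \<iota> h g"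
    then obtain s where s: "s \<in> carrier S" "h = g \<otimes>\<^bsub>G\<^esub> \<iota> s"
        "transition S G \<iota> K \<rho> g h = core_action S K \<rho> s"
      using transition_fraction_leE by blast
    have "core_action S K \<rho> s ` D g \<subseteq> D h"
      using maps[OF gh(2) s(1)] D_core[OF gh(2)] s(2) by (auto simp: core_action_def)
    then show "continuous_map (X g) (X h) (transition S G \<iota> K \<rho> g h)"
      using core_action_continuous[OF s(1)] top gh
      unfolding s(3) X_def
      by (auto simp: continuous_map_in_subtopology continuous_map_from_subtopology)
  next
    fix h k g x
    assume *: "h \<in> carrier G" "k \<in> carrier G" "g \<in> carrier G"
      "fraction_le S G \<iota> h k" "fraction_le S G \<iota> k g" "x \<in> topspace (X g)"
    obtain s where s: "s \<in> carrier S" "k = g \<otimes>\<^bsub>G\<^esub> \<iota> s"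
        "transition S G \<iota> K \<rho> g k = core_action S K \<rho> s"
      using transition_fraction_leE * by blast
    obtain t where t: "t \<in> carrier S" "h = k \<otimes>\<^bsub>G\<^esub> \<iota> t"
        "transition S G \<iota> K \<rho> k h = core_action S K \<rho> t"
      using transition_fraction_leE * by blast
    \<comment> \<open>Going from \<open>g\<close> to \<open>g s\<close> and then to
      \<open>g s t\<close> is a single transition by \<open>s t\<close>, and
      \<open>\<rho> (s t)\<close> is \<open>\<rho> s\<close> followed by \<open>\<rho> t\<close>:
      this is functoriality of the system.\<close>
    have "h = g \<otimes>\<^bsub>G\<^esub> \<iota> (s \<otimes>\<^bsub>S\<^esub> t)"
      using s t * by (simp add: embedding_mult G.m_assoc)
    then have "transition S G \<iota> K \<rho> g h = core_action S K \<rho> (s \<otimes>\<^bsub>S\<^esub> t)"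
      using transition_right_mult(2)[OF fractions] *(3) s(1) t(1) by (metis S.m_closed)
    moreover have "x \<in> core_set" using * top D_core by auto
    ultimately show "transition S G \<iota> K \<rho> k h (transition S G \<iota> K \<rho> g k x) = transition S G \<iota> K \<rho> g h x"
      using s t core_subset action_core_closed by (auto simp: core_action_def action_mult)
  qed
  then obtain x where x: "x \<in> topspace (inverse_limit (carrier G) (fraction_le S G \<iota>) X (transition S G \<iota> K \<rho>))"
    by blast
  then have "x g \<in> D g" if "g \<in> carrier G" for g
    using that top by (auto simp: inverse_limit_def)
  moreover have "x \<in> topspace star"
    using x D_core by (auto simp: star_space_def inverse_limit_def X_def topspace_core_space PiE_iff)
  ultimately show ?thesis by blast
qed

lemma closedin_core_fibre:
  assumes "continuous_map K Y f" "Hausdorff_space Y" "y \<in> topspace Y"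
  shows "closedin (core_space S K \<rho>) {x \<in> core_set. f x = y}"
proof -
  have "{x \<in> core_set. f x = y} = {x \<in> topspace K. f x = y} \<inter> core_set"
    using core_subset by auto
  then show ?thesis
    using closedin_fibre[OF assms] by (auto simp: core_space_def closedin_subtopology)
qed

lemma limit_proj_surj:
  assumes g: "g \<in> carrier G" and y: "y \<in> core_set"
  obtains x where "x \<in> topspace star" "x g = y"
proof -
  \<comment> \<open>At an index \<open>h\<close> above \<open>g\<close> this is the fibre over
    \<open>y\<close> of the transition to \<open>g\<close>; at all other indices the condition is
    vacuous and the whole core remains.\<close>
  define D where "D h = {x \<in> core_set. \<forall>s\<in>carrier S. g = h \<otimes>\<^bsub>G\<^esub> \<iota> s \<longrightarrow> \<rho> s x = y}" for h
  have D_eq: "D h = {x \<in> core_set. \<rho> s x = y}"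
    if "h \<in> carrier G" "s \<in> carrier S" "g = h \<otimes>\<^bsub>G\<^esub> \<iota> s" for h s
  proof -
    \<comment> \<open>The multiplier from \<open>h\<close> to \<open>g\<close> is unique: cancel
      \<open>h\<close> in \<open>G\<close>, then use injectivity of \<open>\<iota>\<close>.\<close>
    have "t = s" if "t \<in> carrier S" "g = h \<otimes>\<^bsub>G\<^esub> \<iota> t" for t
      using that \<open>h \<in> carrier G\<close> \<open>s \<in> carrier S\<close> \<open>g = h \<otimes>\<^bsub>G\<^esub> \<iota> s\<close> embedding_inj
      by (metis G.l_cancel embedding_closed inj_onD)
    with that show ?thesis by (auto simp: D_def)
  qed
  have D_all: "D h = core_set" if "\<not> (\<exists>s\<in>carrier S. g = h \<otimes>\<^bsub>G\<^esub> \<iota> s)" for h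
    using that by (auto simp: D_def)
  have "\<exists>x\<in>topspace star. \<forall>h\<in>carrier G. x h \<in> D h"
  proof (rule star_through_closed_sets)
    fix h assume h: "h \<in> carrier G"
    show "closedin (core_space S K \<rho>) (D h)"
    proof (cases "\<exists>s\<in>carrier S. g = h \<otimes>\<^bsub>G\<^esub> \<iota> s")
      case True
      then obtain s where "s \<in> carrier S" "g = h \<otimes>\<^bsub>G\<^esub> \<iota> s" by blast
      with D_eq[OF h this] show ?thesis
        using y core_subset closedin_core_fibre[OF action_continuous Hausdorff] by auto
    next
      case False
      with D_all show ?thesis by (metis closedin_topspace topspace_core_space)
    qed
    show "D h \<noteq> {}"
    proof (cases "\<exists>s\<in>carrier S. g = h \<otimes>\<^bsub>G\<^esub> \<iota> s")
      case True
      then obtain s where s: "s \<in> carrier S" "g = h \<otimes>\<^bsub>G\<^esub> \<iota> s" by blast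
      obtain x where "x \<in> core_set" "\<rho> s x = y" using s(1) y by (rule action_core_surj)
      with D_eq[OF h s] show ?thesis by auto
    next
      case False
      with D_all[OF this] y show ?thesis by auto
    qed
    fix t x assume t: "t \<in> carrier S" and x: "x \<in> D h"
    \<comment> \<open>If \<open>g\<close> is reached from \<open>h t\<close> by \<open>s\<close>, it
      is reached from \<open>h\<close> by \<open>t s\<close>, so membership of \<open>x\<close> in
      \<open>D h\<close> already determines the value.\<close>
    have "\<rho> s (\<rho> t x) = y" if "s \<in> carrier S" "g = h \<otimes>\<^bsub>G\<^esub> \<iota> t \<otimes>\<^bsub>G\<^esub> \<iota> s" for s
    proof -
      have "g = h \<otimes>\<^bsub>G\<^esub> \<iota> (t \<otimes>\<^bsub>S\<^esub> s)"
        using that t h by (simp add: embedding_mult G.m_assoc)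
      then have "\<rho> (t \<otimes>\<^bsub>S\<^esub> s) x = y" using x t that(1) by (simp add: D_def)
      then show ?thesis using x t that core_subset by (auto simp: D_def action_mult)
    qed
    moreover have "\<rho> t x \<in> core_set" using x t action_core_closed by (simp add: D_def)
    ultimately show "\<rho> t x \<in> D (h \<otimes>\<^bsub>G\<^esub> \<iota> t)" by (simp add: D_def)
  qed
  then obtain x where x: "x \<in> topspace star" "x g \<in> D g" using g by blast
  \<comment> \<open>At the index \<open>g\<close> itself the multiplier is the unit of
    \<open>S\<close>, so the set consists of \<open>y\<close> alone.\<close>
  have "D g = {x \<in> core_set. \<rho> \<one>\<^bsub>S\<^esub> x = y}"
    using g by (intro D_eq) (simp_all add: embedding_one)
  with x have "\<rho> \<one>\<^bsub>S\<^esub> (x g) = y" "x g \<in> core_set" by simp_all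
  then have "x g = y" using core_subset by (auto simp: action_one)
  with x that show thesis by blast
qed

lemma limit_proj_image: "g \<in> carrier G \<Longrightarrow> limit_proj g ` topspace star = core_set"
  unfolding limit_proj_def by (auto intro: star_core elim: limit_proj_surj)

section \<open>The group action on the limit\<close>

text \<open>Compatibility involves right multiplication of indices, which commutes with left
  multiplication by \<open>g\<close>.\<close>

lemma star_shift_in_star:
  assumes "g \<in> carrier G" "x \<in> topspace star"
  shows "(\<lambda>h\<in>carrier G. x (g \<otimes>\<^bsub>G\<^esub> h)) \<in> topspace star"
  using assms by (auto simp: star_iff PiE_iff simp flip: G.m_assoc)

text \<open>Existence and uniqueness at once: all coordinates of \<open>r x\<close> are prescribed.
  The outer restriction normalises values off the star space, the inner one makes each value
  extensional on \<open>carrier G\<close>.\<close>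

lemma is_star_shift_iff:
  assumes g: "g \<in> carrier G"
  shows "is_star_shift S G \<iota> K \<rho> g r \<longleftrightarrow>
    r = (\<lambda>x\<in>topspace star. \<lambda>h\<in>carrier G. x (g \<otimes>\<^bsub>G\<^esub> h))" (is "_ \<longleftrightarrow> r = ?r")
proof
  have "continuous_map star star ?r"
  proof (rule continuous_map_into_star)
    fix h assume "h \<in> carrier G"
    then show "continuous_map star (core_space S K \<rho>) (\<lambda>x. ?r x h)"
      using g by (intro continuous_map_eq[OF continuous_map_limit_proj[of "g \<otimes>\<^bsub>G\<^esub> h"]]) auto
  qed (use g star_shift_in_star in auto)
  then have r: "is_star_shift S G \<iota> K \<rho> g ?r"
    by (simp add: is_star_shift_def limit_proj_def)
  then show "r = ?r \<Longrightarrow> is_star_shift S G \<iota> K \<rho> g r" by simp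
  assume r': "is_star_shift S G \<iota> K \<rho> g r"
  show "r = ?r"
  proof (rule extensionalityI[where A = "topspace star"])
    fix x assume x: "x \<in> topspace star"
    have "r x \<in> topspace star"
      using r' x continuous_map_funspace by (fastforce simp: is_star_shift_def)
    then show "r x = ?r x"
      using x g r' star_shift_in_star[OF g x]
      by (intro star_eqI) (auto simp: is_star_shift_def limit_proj_def)
  qed (use r' in \<open>auto simp: is_star_shift_def\<close>)
qed

lemma star_action_eq:
  "g \<in> carrier G \<Longrightarrow>
    star_action S G \<iota> K \<rho> g = (\<lambda>x\<in>topspace star. \<lambda>h\<in>carrier G. x (g \<otimes>\<^bsub>G\<^esub> h))"
  by (simp add: star_action_def is_star_shift_iff)

lemma right_action_star: "right_action G star (star_action S G \<iota> K \<rho>)"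
  unfolding right_action_def
proof (intro conjI ballI)
  show "continuous_map star star (star_action S G \<iota> K \<rho> g)" if "g \<in> carrier G" for g
    using that is_star_shift_iff[OF that] star_action_eq[OF that] by (metis is_star_shift_def)
next
  fix x assume x: "x \<in> topspace star"
  show "star_action S G \<iota> K \<rho> \<one>\<^bsub>G\<^esub> x = x"
    using x star_shift_in_star[OF G.one_closed x] by (intro star_eqI) (auto simp: star_action_eq)
  \<comment> \<open>The action is a right one because indices are multiplied on the left: shifting
    by \<open>g\<close> and then by \<open>h\<close> gives at \<open>k\<close> the coordinate of
    \<open>x\<close> at \<open>g (h k)\<close>.\<close>
  fix g h assume gh: "g \<in> carrier G" "h \<in> carrier G"
  with x show "star_action S G \<iota> K \<rho> (g \<otimes>\<^bsub>G\<^esub> h) x =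
      star_action S G \<iota> K \<rho> h (star_action S G \<iota> K \<rho> g x)"
    by (auto simp: star_action_eq star_shift_in_star G.m_assoc intro!: restrict_ext)
qed

lemma equivariant_limit_proj_one:
  "equivariant S star (\<lambda>s. star_action S G \<iota> K \<rho> (\<iota> s)) (core_action S K \<rho>) (limit_proj \<one>\<^bsub>G\<^esub>)"
  unfolding equivariant_def
proof (intro ballI)
  fix s x assume s: "s \<in> carrier S" and x: "x \<in> topspace star"
  \<comment> \<open>This is the compatibility of \<open>x\<close> at the index one; its left side is
    the coordinate at one of the shift by \<open>\<iota> s\<close>.\<close>
  have "x (\<one>\<^bsub>G\<^esub> \<otimes>\<^bsub>G\<^esub> \<iota> s) = \<rho> s (x \<one>\<^bsub>G\<^esub>)"
    using s x G.one_closed unfolding star_iff by blast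
  then show "limit_proj \<one>\<^bsub>G\<^esub> (star_action S G \<iota> K \<rho> (\<iota> s) x) = core_action S K \<rho> s (limit_proj \<one>\<^bsub>G\<^esub> x)"
    using s x by (simp add: limit_proj_def star_action_eq core_action_def star_core)
qed

lemma limit_proj_mult:
  "\<lbrakk>g \<in> carrier G; s \<in> carrier S; x \<in> topspace star\<rbrakk>
    \<Longrightarrow> limit_proj (g \<otimes>\<^bsub>G\<^esub> \<iota> s) x = core_action S K \<rho> s (limit_proj g x)"
  using star_core by (simp add: limit_proj_def core_action_def star_iff)

end

section \<open>Maps induced on the limits\<close>

locale compact_right_action_map =
  dom: compact_right_action S G \<iota> K \<rho> + cod: compact_right_action S G \<iota> K' \<rho>'
  for S :: "('s, 'm) monoid_scheme" and G :: "('g, 'n) monoid_scheme" and \<iota> :: "'s \<Rightarrow> 'g"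
    and K :: "'a topology" and \<rho> and K' :: "'b topology" and \<rho>' +
  fixes \<phi> :: "'a \<Rightarrow> 'b"
  assumes continuous: "continuous_map K K' \<phi>" and equivariant: "equivariant S K \<rho> \<rho>' \<phi>"
begin

lemma map_action: "s \<in> carrier S \<Longrightarrow> x \<in> topspace K \<Longrightarrow> \<phi> (\<rho> s x) = \<rho>' s (\<phi> x)"
  using equivariant by (auto simp: equivariant_def)

lemma map_closed: "x \<in> topspace K \<Longrightarrow> \<phi> x \<in> topspace K'"
  using continuous_map_funspace[OF continuous] by auto

text \<open>Equivariance sends a point \<open>\<rho> t y\<close> to
  \<open>\<rho>' t (\<phi> y)\<close>, for each \<open>t\<close> separately.\<close>

lemma map_core:
  assumes "x \<in> dom.core_set"
  shows "\<phi> x \<in> cod.core_set"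
  unfolding core_def
proof
  fix t assume t: "t \<in> carrier S"
  then obtain y where "y \<in> topspace K" "x = \<rho> t y" using assms by (auto simp: core_def)
  then show "\<phi> x \<in> \<rho>' t ` topspace K'" using t by (auto simp: map_action map_closed)
qed

lemma map_core_surj:
  assumes surj: "\<phi> ` topspace K = topspace K'" and y: "y \<in> cod.core_set"
  obtains x where "x \<in> dom.core_set" "\<phi> x = y"
proof -
  have "{x \<in> topspace K. \<phi> x = y} \<inter> dom.core_set \<noteq> {}"
  proof (rule dom.closed_meets_core)
    show "closedin K {x \<in> topspace K. \<phi> x = y}"
      using y cod.core_subset by (intro dom.closedin_fibre[OF continuous cod.Hausdorff]) auto
  next
    fix t assume t: "t \<in> carrier S"
    then have "y \<in> \<rho>' t ` topspace K'" using y by (simp add: core_def)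
    then obtain z where "z \<in> topspace K" "y = \<rho>' t (\<phi> z)"
      unfolding surj[symmetric] by auto
    \<comment> \<open>A preimage of \<open>y\<close> under \<open>\<rho>' t\<close> is lifted
      through \<open>\<phi>\<close> to \<open>z\<close>; by equivariance \<open>\<rho> t z\<close>
      is then a point of the fibre of \<open>\<phi>\<close> inside the image of
      \<open>\<rho> t\<close>.\<close>
    then have "\<rho> t z \<in> {x \<in> topspace K. \<phi> x = y} \<inter> \<rho> t ` topspace K"
      using t by (auto simp: map_action dom.action_closed)
    then show "{x \<in> topspace K. \<phi> x = y} \<inter> \<rho> t ` topspace K \<noteq> {}"
      by (metis empty_iff)
  qed
  with that show thesis by auto
qed

lemma star_map_in_star:
  assumes "x \<in> topspace dom.star"
  shows "(\<lambda>g\<in>carrier G. \<phi> (x g)) \<in> topspace cod.star"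
  using assms dom.core_subset
  by (auto simp: dom.star_iff cod.star_iff PiE_iff map_core map_action subset_iff)

lemma is_star_map_iff:
  "is_star_map S G \<iota> K \<rho> K' \<rho>' \<phi> f \<longleftrightarrow>
    f = (\<lambda>x\<in>topspace dom.star. \<lambda>g\<in>carrier G. \<phi> (x g))" (is "_ \<longleftrightarrow> f = ?f")
proof
  have "continuous_map (core_space S K \<rho>) (core_space S K' \<rho>') \<phi>"
    using continuous map_core dom.topspace_core_space
    by (auto simp: core_space_def continuous_map_in_subtopology continuous_map_from_subtopology)
  then have coord: "continuous_map dom.star (core_space S K' \<rho>') (\<lambda>x. \<phi> (x g))" if "g \<in> carrier G" for g
    using continuous_map_compose[OF dom.continuous_map_limit_proj[OF that]] by (simp add: o_def)
  have "continuous_map dom.star cod.star ?f"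
  proof (rule cod.continuous_map_into_star)
    fix g assume "g \<in> carrier G"
    then show "continuous_map dom.star (core_space S K' \<rho>') (\<lambda>x. ?f x g)"
      by (intro continuous_map_eq[OF coord]) auto
  qed (use star_map_in_star in auto)
  \<comment> \<open>Coordinates of points of the limit lie in the core, where
    \<open>restrict \<phi>\<close> agrees with \<open>\<phi>\<close>.\<close>
  then have "is_star_map S G \<iota> K \<rho> K' \<rho>' \<phi> ?f"
    by (simp add: is_star_map_def limit_proj_def dom.star_core)
  then show "f = ?f \<Longrightarrow> is_star_map S G \<iota> K \<rho> K' \<rho>' \<phi> f" by simp
  assume f: "is_star_map S G \<iota> K \<rho> K' \<rho>' \<phi> f"
  show "f = ?f"
  proof (rule extensionalityI[where A = "topspace dom.star"])
    fix x assume x: "x \<in> topspace dom.star"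
    have "f x \<in> topspace cod.star"
      using f x continuous_map_funspace by (fastforce simp: is_star_map_def)
    then show "f x = ?f x"
      using x f star_map_in_star[OF x]
      by (intro cod.star_eqI) (auto simp: is_star_map_def limit_proj_def dom.star_core)
  qed (use f in \<open>auto simp: is_star_map_def\<close>)
qed

lemma star_map_eq:
  "star_map S G \<iota> K \<rho> K' \<rho>' \<phi> = (\<lambda>x\<in>topspace dom.star. \<lambda>g\<in>carrier G. \<phi> (x g))"
  by (simp add: star_map_def is_star_map_iff)

text \<open>The shift permutes coordinates and the induced map changes each of them by the same
  \<open>\<phi>\<close>, so the two operations commute.\<close>

lemma equivariant_star_map:
  "equivariant G dom.star (star_action S G \<iota> K \<rho>) (star_action S G \<iota> K' \<rho>')
    (star_map S G \<iota> K \<rho> K' \<rho>' \<phi>)"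
  by (auto simp: equivariant_def dom.star_action_eq cod.star_action_eq star_map_eq
      dom.star_shift_in_star star_map_in_star intro!: restrict_ext)

lemma inj_on_star_map:
  assumes "inj_on \<phi> (topspace K)"
  shows "inj_on (star_map S G \<iota> K \<rho> K' \<rho>' \<phi>) (topspace dom.star)"
proof (rule inj_onI)
  fix x y assume xy: "x \<in> topspace dom.star" "y \<in> topspace dom.star"
    and eq: "star_map S G \<iota> K \<rho> K' \<rho>' \<phi> x = star_map S G \<iota> K \<rho> K' \<rho>' \<phi> y"
  show "x = y"
  proof (rule dom.star_eqI[OF xy])
    fix g assume g: "g \<in> carrier G"
    then have "\<phi> (x g) = \<phi> (y g)"
      using fun_cong[OF eq, of g] xy by (simp add: star_map_eq)
    then show "x g = y g"
      using assms dom.star_core[OF _ g] xy dom.core_subset by (meson inj_onD subsetD)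
  qed
qed

lemma star_map_surj:
  assumes surj: "\<phi> ` topspace K = topspace K'"
  shows "star_map S G \<iota> K \<rho> K' \<rho>' \<phi> ` topspace dom.star = topspace cod.star"
proof
  show "star_map S G \<iota> K \<rho> K' \<rho>' \<phi> ` topspace dom.star \<subseteq> topspace cod.star"
    by (auto simp: star_map_eq star_map_in_star)
  show "topspace cod.star \<subseteq> star_map S G \<iota> K \<rho> K' \<rho>' \<phi> ` topspace dom.star"
  proof
    fix y assume y: "y \<in> topspace cod.star"
    \<comment> \<open>A preimage of \<open>y\<close> is a point of the limit running through the
      fibres of \<open>\<phi>\<close> over the coordinates of \<open>y\<close>. The fibres meet the
      core because \<open>\<phi>\<close> maps core onto core, and \<open>\<rho> s\<close> carries
      the fibre over \<open>y g\<close> into the one over \<open>\<rho>' s (y g)\<close>, the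
      coordinate of \<open>y\<close> at \<open>g s\<close>.\<close>
    have "\<exists>x\<in>topspace dom.star. \<forall>g\<in>carrier G. x g \<in> {z \<in> dom.core_set. \<phi> z = y g}"
    proof (rule dom.star_through_closed_sets)
      fix g assume g: "g \<in> carrier G"
      have yg: "y g \<in> cod.core_set" using y g by (rule cod.star_core)
      show "closedin (core_space S K \<rho>) {z \<in> dom.core_set. \<phi> z = y g}"
        using yg cod.core_subset by (intro dom.closedin_core_fibre[OF continuous cod.Hausdorff]) auto
      show "{z \<in> dom.core_set. \<phi> z = y g} \<noteq> {}"
        using map_core_surj[OF surj yg] by blast
      show "\<rho> s z \<in> {z \<in> dom.core_set. \<phi> z = y (g \<otimes>\<^bsub>G\<^esub> \<iota> s)}"
        if "s \<in> carrier S" "z \<in> {z \<in> dom.core_set. \<phi> z = y g}" for s z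
        using that g y dom.core_subset
        by (auto simp: dom.action_core_closed map_action cod.star_iff subset_iff)
    qed
    then obtain x where x: "x \<in> topspace dom.star" "\<forall>g\<in>carrier G. \<phi> (x g) = y g" by auto
    have "star_map S G \<iota> K \<rho> K' \<rho>' \<phi> x = y"
      using x y star_map_in_star[OF x(1)] by (intro cod.star_eqI) (auto simp: star_map_eq)
    with x show "y \<in> star_map S G \<iota> K \<rho> K' \<rho>' \<phi> ` topspace dom.star" by blast
  qed
qed

end

theorem lemma3p12:
  fixes S :: "('s, 'm) monoid_scheme"
    and I :: "'i set" and leq :: "'i \<Rightarrow> 'i \<Rightarrow> bool" and F :: "'i \<Rightarrow> 's set"
    and G :: "('g, 'n) monoid_scheme" and \<iota> :: "'s \<Rightarrow> 'g"
    and K :: "'a topology" and \<rho> :: "'s \<Rightarrow> 'a \<Rightarrow> 'a"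
  assumes "monoid_cancel S"
    and "right_Folner_net S I leq F"
    and "group_of_left_fractions S G \<iota>"
    and "compact_space K" and "Hausdorff_space K"
    and "right_action S K \<rho>"
  shows
    "(\<forall>g\<in>carrier G.
        limit_proj g ` topspace (star_space S G \<iota> K \<rho>) = topspace (core_space S K \<rho>) \<and>
        (\<forall>s\<in>carrier S. \<forall>x\<in>topspace (star_space S G \<iota> K \<rho>).
           limit_proj (g \<otimes>\<^bsub>G\<^esub> \<iota> s) x = core_action S K \<rho> s (limit_proj g x)))
   \<and> ((\<forall>g\<in>carrier G. \<exists>!r. is_star_shift S G \<iota> K \<rho> g r) \<and>
      right_action G (star_space S G \<iota> K \<rho>) (star_action S G \<iota> K \<rho>))
   \<and> (limit_proj \<one>\<^bsub>G\<^esub> ` topspace (star_space S G \<iota> K \<rho>) = topspace (core_space S K \<rho>) \<and>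
      equivariant S (star_space S G \<iota> K \<rho>)
        (\<lambda>s. star_action S G \<iota> K \<rho> (\<iota> s)) (core_action S K \<rho>) (limit_proj \<one>\<^bsub>G\<^esub>))
   \<and> (\<forall>(K' :: 'b topology) \<rho>' \<phi>.
        compact_space K' \<and> Hausdorff_space K' \<and> right_action S K' \<rho>' \<and>
        continuous_map K K' \<phi> \<and> equivariant S K \<rho> \<rho>' \<phi> \<longrightarrow>
          (\<exists>!f. is_star_map S G \<iota> K \<rho> K' \<rho>' \<phi> f) \<and>
          equivariant G (star_space S G \<iota> K \<rho>)
            (star_action S G \<iota> K \<rho>) (star_action S G \<iota> K' \<rho>') (star_map S G \<iota> K \<rho> K' \<rho>' \<phi>) \<and>
          (inj_on \<phi> (topspace K) \<longrightarrow>
             inj_on (star_map S G \<iota> K \<rho> K' \<rho>' \<phi>) (topspace (star_space S G \<iota> K \<rho>))) \<and>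
          (\<phi> ` topspace K = topspace K' \<longrightarrow>
             star_map S G \<iota> K \<rho> K' \<rho>' \<phi> ` topspace (star_space S G \<iota> K \<rho>)
               = topspace (star_space S G \<iota> K' \<rho>')))"
proof -
  interpret compact_right_action S G \<iota> K \<rho>
    using assms
    by (intro compact_right_action.intro left_fractions.intro compact_right_action_axioms.intro
        left_fractions_axioms.intro)
      (auto simp: group_of_left_fractions_def monoid_cancel_def)
  \<comment> \<open>The second space, action and map are universally quantified, so these claims are
    proved for arbitrary ones, with the two-space locale interpreted locally.\<close>
  have part4: "(\<exists>!f. is_star_map S G \<iota> K \<rho> K' \<rho>' \<phi> f) \<and>
      equivariant G (star_space S G \<iota> K \<rho>)
        (star_action S G \<iota> K \<rho>) (star_action S G \<iota> K' \<rho>') (star_map S G \<iota> K \<rho> K' \<rho>' \<phi>) \<and>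
      (inj_on \<phi> (topspace K) \<longrightarrow>
         inj_on (star_map S G \<iota> K \<rho> K' \<rho>' \<phi>) (topspace (star_space S G \<iota> K \<rho>))) \<and>
      (\<phi> ` topspace K = topspace K' \<longrightarrow>
         star_map S G \<iota> K \<rho> K' \<rho>' \<phi> ` topspace (star_space S G \<iota> K \<rho>)
           = topspace (star_space S G \<iota> K' \<rho>'))"
    if "compact_space K'" "Hausdorff_space K'" "right_action S K' \<rho>'"
      "continuous_map K K' \<phi>" "equivariant S K \<rho> \<rho>' \<phi>"
    for K' :: "'b topology" and \<rho>' \<phi>
  proof -
    interpret compact_right_action_map S G \<iota> K \<rho> K' \<rho>' \<phi>
      using that by unfold_locales
    show ?thesis
      by (simp add: is_star_map_iff equivariant_star_map inj_on_star_map star_map_surj)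
  qed
  show ?thesis
    using part4 by (simp add: limit_proj_image topspace_core_space limit_proj_mult is_star_shift_iff
        right_action_star equivariant_limit_proj_one)
qed

end
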